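(* Let $a,b,c>0$ and $p$ be real numbers, let $\mathcal{G}_p(x)=(1-x)^p\exp\left(F(a,b;c;x)\right)$, and let $v_n=v_n(p)$ be its Maclaurin coefficients, i.e. $\mathcal{G}_p(x)=\sum_{n=0}^\infty v_nx^n$. (1) Suppose $c\le a+b$. - If $p\le\frac{ab}{c}$, then for all $x\in(0,1)$ and all integers $n\ge0$, $$F(a,b;c;x)>\ln\left[\frac{\sum_{j=0}^nv_jx^j}{(1-x)^p}\right].$$ - If $c=a+b$, $a+b\ge2ab(a+b+1)$ and $\frac{ab(2a+2b+1)}{a+b}\le p\le1$, then for all $x\in(0,1)$ and all integers $n\ge1$, $$F(a,b;c;x)<\ln\left[\frac{\sum_{j=0}^nv_jx^j}{(1-x)^p}\right].$$ (2) Suppose $c\ge a+b+ab$. If $\frac{ab}{c}\le p\le1$, then for all $x\in(0,1)$ and all integers $n\ge1$, $$\ln\left[\frac{\sum_{j=0}^nv_jx^j-\left(\sum_{j=0}^nv_j\right)x^{n+1}}{(1-x)^p}\right]<F(a,b;c;x)<\ln\left[\frac{\sum_{j=0}^{n+1}v_jx^j}{(1-x)^p}\right].$$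
   Context: $F(a,b;c;x)=\sum_{n=0}^\infty\frac{(a)_n(b)_n}{(c)_n}\frac{x^n}{n!}$ is the Gaussian hypergeometric function, with $(a)_0=1$ and $(a)_n=a(a+1)\cdots(a+n-1)$ for $n\ge1$. *)

theory Defs
  imports "HOL-Analysis.Analysis"
begin

definition hyp2F1 :: "real \<Rightarrow> real \<Rightarrow> real \<Rightarrow> real \<Rightarrow> real" where
  "hyp2F1 a b c x =
     (\<Sum>n. pochhammer a n * pochhammer b n / pochhammer c n * (x ^ n / fact n))"

definition G_fun :: "real \<Rightarrow> real \<Rightarrow> real \<Rightarrow> real \<Rightarrow> real \<Rightarrow> real" where
  "G_fun a b c p x = (1 - x) powr p * exp (hyp2F1 a b c x)"

definition maclaurin_coeff :: "(real \<Rightarrow> real) \<Rightarrow> nat \<Rightarrow> real" where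
  "maclaurin_coeff f n = (deriv ^^ n) f 0 / fact n"

definition v_coeff :: "real \<Rightarrow> real \<Rightarrow> real \<Rightarrow> real \<Rightarrow> nat \<Rightarrow> real" where
  "v_coeff a b c p n = maclaurin_coeff (G_fun a b c p) n"

end

theory Submission
  imports Defs "HOL-Real_Asymp.Real_Asymp"
begin

text \<open>
  After exponentiating and multiplying by \<open>(1 - x)\<^sup>p\<close>, every claim compares the
  power series \<open>G(x) = (1 - x)\<^sup>p exp F(x) = \<Sum> v\<^sub>n x\<^sup>n\<close> with one of its truncations, so
  everything depends on the signs of the coefficients. These are read off from the logarithmic
  derivative \<open>G'/G = F' - p/(1 - x)\<close>, whose coefficients are \<open>e\<^sub>k - p\<close>, where \<open>e\<^sub>k\<close> are the
  coefficients of \<open>F'\<close>. They yield the recurrence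
  \<open>(n + 1) v\<^sub>n\<^sub>+\<^sub>1 = \<Sum>k\<le>n. (e\<^sub>k - p) v\<^sub>n\<^sub>-\<^sub>k\<close> with \<open>v\<^sub>0 = e > 0\<close>, and three behaviours of \<open>e\<^sub>k\<close> matter.

  If \<open>c \<le> a + b\<close>, then \<open>e\<^sub>k\<close> increases from \<open>ab/c\<close>. For \<open>p \<le> ab/c\<close> the recurrence has
  nonnegative coefficients, so all \<open>v\<^sub>n\<close> are nonnegative and truncations lie below \<open>G\<close>.

  If \<open>c = a + b\<close> and \<open>p\<close> is large, then \<open>t\<^sub>k = p - e\<^sub>k\<close> is positive and log-convex, and
  \<open>t\<^sub>0\<^sup>2 < t\<^sub>1\<close>. As in Kaluza's theorem on reciprocals of log-convex series, comparing
  consecutive instances of the recurrence shows that every coefficient after \<open>v\<^sub>0\<close> is negative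
  (\<open>log_deriv_coeffs_neg_if_log_convex\<close>). The log-convexity rests on the bound
  \<open>e\<^sub>k \<le> (ab/c)(c + 1)\<close>, obtained from a telescoping estimate of the product that defines \<open>e\<^sub>k\<close>.

  If \<open>c \<ge> a + b + ab\<close>, then \<open>e\<^sub>k\<close> decreases and \<open>p - e\<^sub>k\<close> increases. The partial sums \<open>S\<^sub>n\<close> of
  \<open>v\<close> are the coefficients of \<open>G/(1 - x)\<close>, whose logarithmic derivative has coefficients
  \<open>e\<^sub>k + 1 - p > 0\<close>; hence \<open>S\<^sub>n > 0\<close>. The lower bound is exactly \<open>1 - x\<close> times a truncation of
  \<open>\<Sum> S\<^sub>n x\<^sup>n\<close>. Positivity of \<open>S\<^sub>n\<close> together with monotonicity of \<open>p - e\<^sub>k\<close> also forces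
  \<open>v\<^sub>n \<le> 0\<close> for positive \<open>n\<close>, which gives the upper bound.
\<close>

section \<open>Power series determined by their logarithmic derivative\<close>

lemma log_deriv_recurrence:
  fixes G L :: "'a :: comm_ring_1 fps"
  assumes "fps_deriv G = G * L"
  shows "of_nat (Suc n) * fps_nth G (Suc n) = (\<Sum>k\<le>n. fps_nth L k * fps_nth G (n - k))"
proof -
  have "of_nat (Suc n) * fps_nth G (Suc n) = fps_nth (L * G) n"
    using assms by (metis fps_deriv_nth mult.commute Suc_eq_plus1)
  then show ?thesis by (simp add: fps_mult_nth atLeast0AtMost)
qed

text \<open>
  The linear equation \<open>G' = G L\<close> can only be singular where \<open>L\<close> is. In terms of coefficients: for
  \<open>\<rho>\<close> inside the disc of \<open>L\<close> the numbers \<open>|G\<^sub>n| \<rho>\<^sup>n\<close> are bounded, because the recurrence divides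
  by \<open>n + 1\<close>, which eventually exceeds \<open>\<rho> \<Sum> |L\<^sub>k| \<rho>\<^sup>k\<close>.
\<close>

lemma fps_conv_radius_log_deriv:
  fixes G L :: "'a :: {banach, real_normed_field} fps"
  assumes ode: "fps_deriv G = G * L"
  shows "fps_conv_radius L \<le> fps_conv_radius G"
  unfolding fps_conv_radius_def[of G]
proof (rule conv_radius_geI_ex')
  fix r :: real assume r: "0 < r" "ereal r < fps_conv_radius L"
  then obtain \<rho> where \<rho>: "r < \<rho>" "ereal \<rho> < fps_conv_radius L"
    by (metis ereal_dense2 ereal_less(2) less_ereal.simps(1))
  define l where "l k = norm (fps_nth L k) * \<rho> ^ k" for k
  define h where "h k = norm (fps_nth G k) * \<rho> ^ k" for k
  have \<rho>0: "\<rho> > 0" using r \<rho> by simp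
  have "summable (\<lambda>n. norm (fps_nth L n * of_real \<rho> ^ n))"
    using \<rho> \<rho>0 by (intro norm_summable_fps) auto
  then have l_sum: "summable l"
    using \<rho>0 by (simp add: l_def [abs_def] norm_mult norm_power)
  define C where "C = suminf l"
  have l0: "l k \<ge> 0" for k using \<rho>0 by (simp add: l_def)
  have h0: "h k \<ge> 0" for k using \<rho>0 by (simp add: h_def)
  \<comment> \<open>Beyond \<open>N\<close> the division by \<open>n\<close> absorbs the factor \<open>\<rho> * C\<close> picked up by the recurrence.\<close>
  define N where "N = nat \<lceil>\<rho> * C\<rceil>"
  define A where "A = Max (h ` {..N})"
  have A0: "A \<ge> 0" using h0[of 0] unfolding A_def by (subst Max_ge_iff) auto
  have hA: "h n \<le> A" for n
  proof (induction n rule: less_induct)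
    case (less n)
    show ?case
    proof (cases "n \<le> N")
      case True
      then show ?thesis unfolding A_def by (intro Max_ge) auto
    next
      case False
      then obtain m where m: "n = Suc m" by (cases n) auto
      have "real (Suc m) * norm (fps_nth G (Suc m))
              = norm (of_nat (Suc m) * fps_nth G (Suc m))"
        by (simp only: norm_mult norm_of_nat)
      also have "\<dots> = norm (\<Sum>k\<le>m. fps_nth L k * fps_nth G (m - k))"
        by (simp only: log_deriv_recurrence[OF ode])
      also have "\<dots> \<le> (\<Sum>k\<le>m. norm (fps_nth L k) * norm (fps_nth G (m - k)))"
        by (rule order.trans[OF norm_sum]) (simp add: norm_mult)
      finally have "real (Suc m) * norm (fps_nth G (Suc m)) * \<rho> ^ Suc m
          \<le> (\<Sum>k\<le>m. norm (fps_nth L k) * norm (fps_nth G (m - k))) * \<rho> ^ Suc m"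
        using \<rho>0 by (intro mult_right_mono) auto
      also have "\<dots> = \<rho> * (\<Sum>k\<le>m. l k * h (m - k))"
        unfolding sum_distrib_left sum_distrib_right
      proof (rule sum.cong)
        fix k assume "k \<in> {..m}"
        then have "\<rho> ^ Suc m = \<rho> * (\<rho> ^ k * \<rho> ^ (m - k))"
          by (simp flip: power_add)
        then show "norm (fps_nth L k) * norm (fps_nth G (m - k)) * \<rho> ^ Suc m = \<rho> * (l k * h (m - k))"
          by (simp add: l_def h_def)
      qed simp
      also have "\<dots> \<le> \<rho> * (\<Sum>k\<le>m. l k * A)"
        using \<rho>0 l0 less.IH m by (intro mult_left_mono sum_mono) auto
      also have "\<dots> = \<rho> * A * (\<Sum>k\<le>m. l k)" by (simp add: sum_distrib_right[symmetric])
      also have "\<dots> \<le> \<rho> * A * C"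
        unfolding C_def using A0 \<rho>0 l0 l_sum by (intro mult_left_mono sum_le_suminf) auto
      also have "\<dots> \<le> real (Suc m) * A"
      proof -
        have "\<rho> * C \<le> real (Suc m)" using False m unfolding N_def by linarith
        from mult_right_mono[OF this A0] show ?thesis by (simp add: mult_ac)
      qed
      finally have "real (Suc m) * h n \<le> real (Suc m) * A"
        by (simp add: m h_def mult_ac)
      then show ?thesis by (rule mult_left_le_imp_le) simp
    qed
  qed
  have bound: "norm (fps_nth G n * of_real r ^ n) \<le> A * (r / \<rho>) ^ n" for n
  proof -
    have "norm (fps_nth G n * of_real r ^ n) = h n * (r / \<rho>) ^ n"
      using r \<rho>0 by (simp add: h_def norm_mult norm_power power_divide)
    also have "\<dots> \<le> A * (r / \<rho>) ^ n"
      using r \<rho>0 hA by (intro mult_right_mono) auto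
    finally show ?thesis .
  qed
  have "summable (\<lambda>n. A * (r / \<rho>) ^ n)"
    using r \<rho> \<rho>0 by (intro summable_mult summable_geometric) auto
  then show "summable (\<lambda>n. fps_nth G n * of_real r ^ n)"
    by (rule summable_comparison_test') (rule bound)
qed

section \<open>Sign patterns of the coefficients\<close>

text \<open>
  The recurrence only adds nonnegative terms. The product of \<open>L\<^sub>n\<close> with the constant coefficient
  of \<open>G\<close> occurs among them, and it makes the next coefficient strictly positive once \<open>L\<^sub>n > 0\<close>.
\<close>

lemma
  fixes G L :: "real fps"
  assumes ode: "fps_deriv G = G * L" and "fps_nth G 0 > 0"
    and "\<And>k. fps_nth L k \<ge> 0" and "\<And>k. k \<ge> m \<Longrightarrow> fps_nth L k > 0"
  shows log_deriv_coeffs_nonneg: "fps_nth G n \<ge> 0"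
    and log_deriv_coeffs_pos: "n > m \<Longrightarrow> fps_nth G n > 0"
proof -
  have nonneg: "fps_nth G n \<ge> 0" for n
  proof (induction n rule: less_induct)
    case (less n)
    show ?case
    proof (cases n)
      case (Suc j)
      have "(\<Sum>k\<le>j. fps_nth L k * fps_nth G (j - k)) \<ge> 0"
        using assms(3) less.IH Suc by (intro sum_nonneg mult_nonneg_nonneg) auto
      then have "0 \<le> real (Suc j) * fps_nth G (Suc j)"
        by (simp only: log_deriv_recurrence[OF ode])
      then show ?thesis using Suc by (simp add: zero_le_mult_iff)
    qed (use assms(2) in simp)
  qed
  then show "fps_nth G n \<ge> 0" .
  assume "n > m"
  then obtain j where j: "n = Suc j" "j \<ge> m" by (cases n) auto
  have "(\<Sum>k\<le>j. fps_nth L k * fps_nth G (j - k)) > 0"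
    using assms j nonneg by (intro sum_pos2[where i = j] mult_nonneg_nonneg) auto
  then have "0 < real (Suc j) * fps_nth G (Suc j)"
    by (simp only: log_deriv_recurrence[OF ode])
  then show "fps_nth G n > 0" using j by (simp add: zero_less_mult_iff)
qed

lemma log_convex_ratio_mono:
  fixes t :: "nat \<Rightarrow> real"
  assumes "\<And>k. t k > 0" and "\<And>k. t (Suc k) ^ 2 \<le> t k * t (Suc (Suc k))" and "k \<le> n"
  shows "t (Suc k) / t k \<le> t (Suc n) / t n"
proof -
  have "incseq (\<lambda>k. t (Suc k) / t k)"
    using assms(1,2) by (intro incseq_SucI) (simp add: field_simps power2_eq_square)
  then show ?thesis using assms(3) by (auto dest: incseqD)
qed

text \<open>
  In the recurrence for \<open>L = -t\<close> the positive constant coefficient pushes downwards, while the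
  coefficients that are already negative push upwards. Log-convexity controls the balance: with
  \<open>\<rho> = t\<^sub>n\<^sub>+\<^sub>1/t\<^sub>n\<close> one has \<open>t\<^sub>k\<^sub>+\<^sub>1 \<le> \<rho> t\<^sub>k\<close> for all \<open>k \<le> n\<close>, with equality at \<open>k = n\<close>, the only
  index where \<open>t\<^sub>k\<close> meets the positive coefficient. Hence
  \<open>\<Sum>k\<le>n. t\<^sub>k\<^sub>+\<^sub>1 G\<^sub>n\<^sub>-\<^sub>k\<close> is at least \<open>\<rho> \<Sum>k\<le>n. t\<^sub>k G\<^sub>n\<^sub>-\<^sub>k = - \<rho> (n + 1) G\<^sub>n\<^sub>+\<^sub>1\<close>, and the next
  instance of the recurrence, which has the additional term \<open>- t\<^sub>0 G\<^sub>n\<^sub>+\<^sub>1\<close>, gives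
  \<open>(n + 2) G\<^sub>n\<^sub>+\<^sub>2 \<le> (\<rho> (n + 1) - t\<^sub>0) G\<^sub>n\<^sub>+\<^sub>1\<close>. The factor is positive because \<open>\<rho> \<ge> t\<^sub>1/t\<^sub>0 > t\<^sub>0\<close>.
\<close>

lemma log_deriv_coeffs_neg_if_log_convex:
  fixes G L :: "real fps" and t :: "nat \<Rightarrow> real"
  assumes ode: "fps_deriv G = G * L" and g0: "fps_nth G 0 > 0"
    and L: "\<And>k. fps_nth L k = - t k" and t: "\<And>k. t k > 0"
    and log_convex: "\<And>k. t (Suc k) ^ 2 \<le> t k * t (Suc (Suc k))"
    and start: "t 0 ^ 2 < t 1"
  shows "fps_nth G (Suc n) < 0"
proof (induction n rule: less_induct)
  case (less n)
  show ?case
  proof (cases n)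
    case 0
    show ?thesis
      using log_deriv_recurrence[OF ode, of 0] L[of 0] t[of 0] g0 0 by simp
  next
    case (Suc m)
    define \<rho> where "\<rho> = t (Suc m) / t m"
    have ratio: "t (Suc k) \<le> \<rho> * t k" if "k \<le> m" for k
      using log_convex_ratio_mono[of t k m, OF t log_convex that] t[of k] by (simp add: \<rho>_def field_simps)
    have "t 0 < t 1 / t 0"
      using start t[of 0] by (simp add: field_simps power2_eq_square)
    also have "\<dots> \<le> \<rho>"
      using log_convex_ratio_mono[of t 0 m, OF t log_convex] by (simp add: \<rho>_def)
    finally have \<rho>: "t 0 < \<rho>" .
    have "real (Suc n) * fps_nth G (Suc n)
        = - (t 0 * fps_nth G (Suc m)) - (\<Sum>k\<le>m. t (Suc k) * fps_nth G (m - k))"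
      unfolding log_deriv_recurrence[OF ode] Suc
      by (subst sum.atMost_Suc_shift) (simp add: L sum_negf)
    also have "\<dots> \<le> - (t 0 * fps_nth G (Suc m)) - (\<Sum>k\<le>m. \<rho> * t k * fps_nth G (m - k))"
    proof -
      have "\<rho> * t k * fps_nth G (m - k) \<le> t (Suc k) * fps_nth G (m - k)" if "k \<le> m" for k
      proof (cases "k = m")
        \<comment> \<open>The positive constant coefficient of \<open>G\<close>: here equality is needed.\<close>
        case True
        have "\<rho> * t m = t (Suc m)" using t[of m] by (simp add: \<rho>_def)
        then show ?thesis using True by simp
      next
        case False
        then have "fps_nth G (m - k) < 0"
          using less.IH[of "m - k - 1"] that Suc by (simp add: Suc_diff_Suc)
        then show ?thesis using ratio[OF that] by (intro mult_right_mono_neg) auto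
      qed
      then have "(\<Sum>k\<le>m. \<rho> * t k * fps_nth G (m - k)) \<le> (\<Sum>k\<le>m. t (Suc k) * fps_nth G (m - k))"
        by (intro sum_mono) auto
      then show ?thesis by simp
    qed
    also have "\<dots> = (\<rho> * real (Suc m) - t 0) * fps_nth G (Suc m)"
    proof -
      have "(\<Sum>k\<le>m. \<rho> * t k * fps_nth G (m - k)) = - (\<rho> * (real (Suc m) * fps_nth G (Suc m)))"
        unfolding log_deriv_recurrence[OF ode]
        by (simp add: L sum_distrib_left sum_negf mult_ac)
      then show ?thesis by (simp add: algebra_simps)
    qed
    also have "\<dots> < 0"
    proof (rule mult_pos_neg)
      have "\<rho> * 1 \<le> \<rho> * real (Suc m)"
        using \<rho> t[of 0] by (intro mult_left_mono) auto
      then show "0 < \<rho> * real (Suc m) - t 0" using \<rho> by simp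
      show "fps_nth G (Suc m) < 0" using less.IH[of m] Suc by simp
    qed
    finally show ?thesis by (simp add: mult_less_0_iff)
  qed
qed

text \<open>
  If \<open>t\<close> is nondecreasing, replacing every \<open>t\<^sub>k\<close> in the recurrence by \<open>t\<^sub>n\<close> can only increase the
  right-hand side, since the coefficients multiplied by the changed weights are nonpositive by
  induction. What remains is \<open>- t\<^sub>n\<close> times a partial sum of the coefficients.
\<close>

lemma log_deriv_coeffs_neg_if_partial_sums_pos:
  fixes G L :: "real fps" and t :: "nat \<Rightarrow> real"
  assumes ode: "fps_deriv G = G * L" 
    and L: "\<And>k. fps_nth L k = - t k" and t: "\<And>k. t k \<ge> 0" and mono: "mono t"
    and sums: "\<And>n. (\<Sum>j\<le>n. fps_nth G j) > 0"
    and "t n > 0"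
  shows "fps_nth G (Suc n) < 0"
proof -
  have bound: "real (Suc n) * fps_nth G (Suc n) \<le> - (t n * (\<Sum>j\<le>n. fps_nth G j))"
    if "\<And>j. j < n \<Longrightarrow> fps_nth G (Suc j) \<le> 0" for n
  proof -
    have "t n * fps_nth G (n - k) \<le> t k * fps_nth G (n - k)" if "k \<le> n" for k
    proof (cases "k = n")
      case False
      with that \<open>\<And>j. j < n \<Longrightarrow> fps_nth G (Suc j) \<le> 0\<close>[of "n - k - 1"]
      have "fps_nth G (n - k) \<le> 0" by (simp add: Suc_diff_Suc)
      then show ?thesis using monoD[OF mono that] by (intro mult_right_mono_neg) auto
    qed simp
    then have "(\<Sum>k\<le>n. t n * fps_nth G (n - k)) \<le> (\<Sum>k\<le>n. t k * fps_nth G (n - k))"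
      by (intro sum_mono) auto
    moreover have "(\<Sum>k\<le>n. fps_nth G (n - k)) = (\<Sum>j\<le>n. fps_nth G j)"
      by (rule sum.nat_diff_reindex[of _ "Suc n", unfolded lessThan_Suc_atMost, simplified])
    ultimately show ?thesis
      unfolding log_deriv_recurrence[OF ode] by (simp add: L sum_negf flip: sum_distrib_left)
  qed
  have nonpos: "fps_nth G (Suc n) \<le> 0" for n
  proof (induction n rule: less_induct)
    case (less n)
    have "0 \<le> t n * (\<Sum>j\<le>n. fps_nth G j)"
      using t[of n] sums[of n] by (intro mult_nonneg_nonneg) auto
    with bound[of n] less.IH have "real (Suc n) * fps_nth G (Suc n) \<le> 0" by fastforce
    then show ?case by (simp add: mult_le_0_iff)
  qed
  have "0 < t n * (\<Sum>j\<le>n. fps_nth G j)" using \<open>t n > 0\<close> sums[of n] by simp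
  with bound[OF nonpos, of n] have "real (Suc n) * fps_nth G (Suc n) < 0" by linarith
  then show ?thesis by (simp add: mult_less_0_iff)
qed

section \<open>Truncated power series\<close>

lemma truncation_less_eval_fps:
  fixes G :: "real fps"
  assumes "0 < x" "ereal x < fps_conv_radius G"
    and "\<And>j. j > n \<Longrightarrow> fps_nth G j \<ge> 0" and "m > n" "fps_nth G m > 0"
  shows "(\<Sum>j=0..n. fps_nth G j * x ^ j) < eval_fps G x"
proof -
  have "sum (\<lambda>j. fps_nth G j * x ^ j) {..<Suc n} < (\<Sum>j. fps_nth G j * x ^ j)"
    using assms by (intro sum_less_suminf2[where i = m] summable_fps) auto
  then show ?thesis
    by (simp only: eval_fps_def lessThan_Suc_atMost atLeast0AtMost)
qed

lemma eval_fps_less_truncation: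
  fixes G :: "real fps"
  assumes x: "0 < x" "ereal x < fps_conv_radius G"
    and "\<And>j. j > n \<Longrightarrow> fps_nth G j \<le> 0" and "m > n" "fps_nth G m < 0"
  shows "eval_fps G x < (\<Sum>j=0..n. fps_nth G j * x ^ j)"
  using truncation_less_eval_fps[of x "- G" n m] assms
  by (simp add: eval_fps_minus sum_negf)

definition geometric_fps :: "real fps" where
  "geometric_fps = Abs_fps (\<lambda>_. 1)"

lemma fps_nth_geometric [simp]: "fps_nth geometric_fps n = 1"
  by (simp add: geometric_fps_def)

lemma fps_nth_mult_geometric: "fps_nth (G * geometric_fps) n = (\<Sum>j\<le>n. fps_nth G j)"
  by (simp add: fps_mult_nth atLeast0AtMost)

lemma fps_conv_radius_geometric: "fps_conv_radius geometric_fps = 1"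
proof -
  have "conv_radius (\<lambda>n. 1 :: real) = ereal 1"
    by (rule conv_radius_ratio_limit_nonzero) auto
  then show ?thesis
    by (simp add: fps_conv_radius_def geometric_fps_def one_ereal_def)
qed

lemma eval_fps_geometric: "\<bar>x\<bar> < 1 \<Longrightarrow> eval_fps geometric_fps x = 1 / (1 - x)"
  by (simp add: eval_fps_def suminf_geometric)

lemma fps_deriv_geometric: "fps_deriv geometric_fps = geometric_fps * geometric_fps"
  by (rule fps_ext) (simp add: fps_nth_mult_geometric)

text \<open>
  Summation by parts. The correction term in the lower bound is the one that makes
  the polynomial divisible by \<open>1 - x\<close>; the quotient is the truncation of \<open>G/(1 - x)\<close>.
\<close>

lemma geometric_truncation:
  fixes g :: "nat \<Rightarrow> real"
  shows "(\<Sum>j=0..n. g j * x ^ j) - (\<Sum>j=0..n. g j) * x ^ (n + 1)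
           = (1 - x) * (\<Sum>m=0..n. (\<Sum>j\<le>m. g j) * x ^ m)"
proof (induction n)
  case (Suc n)
  then show ?case by (simp add: atLeast0AtMost algebra_simps)
qed (simp add: algebra_simps)

section \<open>The function G and its power series\<close>

definition hyp_fps :: "real \<Rightarrow> real \<Rightarrow> real \<Rightarrow> real fps" where
  "hyp_fps a b c = Abs_fps (\<lambda>n. pochhammer a n * pochhammer b n / pochhammer c n / fact n)"

lemma eval_hyp_fps: "eval_fps (hyp_fps a b c) x = hyp2F1 a b c x"
  by (simp add: eval_fps_def hyp_fps_def hyp2F1_def)

lemma hyp_fps_Suc:
  "fps_nth (hyp_fps a b c) (Suc n)
           = fps_nth (hyp_fps a b c) n * ((a + n) * (b + n) / ((real n + 1) * (c + n)))"
  by (simp add: hyp_fps_def pochhammer_rec' mult_ac)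

lemma hyp_fps_pos:
  assumes "a > 0" "b > 0" "c > 0"
  shows "fps_nth (hyp_fps a b c) n > 0"
  using assms by (simp add: hyp_fps_def pochhammer_pos)

lemma fps_conv_radius_hyp:
  assumes "a > 0" "b > 0" "c > 0"
  shows "fps_conv_radius (hyp_fps a b c) = 1"
proof -
  let ?f = "fps_nth (hyp_fps a b c)"
  have "norm (?f n) / norm (?f (Suc n)) = (n + 1) * (c + n) / ((a + n) * (b + n))" for n
    using hyp_fps_pos[OF assms, of n] hyp_fps_pos[OF assms, of "Suc n"] assms
    by (simp add: hyp_fps_Suc)
  moreover have "(\<lambda>n. (real n + 1) * (c + n) / ((a + n) * (b + n))) \<longlonglongrightarrow> 1"
    by real_asymp
  ultimately have "(\<lambda>n. norm (?f n) / norm (?f (Suc n))) \<longlonglongrightarrow> 1" by simp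
  then have "conv_radius ?f = ereal 1"
    by (intro conv_radius_ratio_limit_nonzero) auto
  then show ?thesis by (simp add: fps_conv_radius_def one_ereal_def)
qed

text \<open>These are the numbers \<open>e\<^sub>k\<close> of the introduction.\<close>

definition hyp_deriv_coeff :: "real \<Rightarrow> real \<Rightarrow> real \<Rightarrow> nat \<Rightarrow> real" where
  "hyp_deriv_coeff a b c = fps_nth (fps_deriv (hyp_fps a b c))"

lemma hyp_deriv_coeff_0: "hyp_deriv_coeff a b c 0 = a * b / c"
  by (simp add: hyp_deriv_coeff_def hyp_fps_def)

lemma hyp_deriv_coeff_Suc:
  "hyp_deriv_coeff a b c (Suc k)
           = hyp_deriv_coeff a b c k * ((a + k + 1) * (b + k + 1) / ((real k + 1) * (c + k + 1)))"
proof -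
  have "hyp_deriv_coeff a b c (Suc k) = (real k + 2) * fps_nth (hyp_fps a b c) (Suc (Suc k))"
    by (simp add: hyp_deriv_coeff_def)
  also have "\<dots> = fps_nth (hyp_fps a b c) (Suc k) * ((a + k + 1) * (b + k + 1) / (c + k + 1))"
  proof -
    have "real (Suc k) + 1 = real k + 2" "y + real (Suc k) = y + k + 1" for y by simp_all
    from hyp_fps_Suc[of a b c "Suc k", unfolded this] show ?thesis by simp
  qed
  also have "\<dots> = (real k + 1) * fps_nth (hyp_fps a b c) (Suc k)
      * ((a + k + 1) * (b + k + 1) / ((real k + 1) * (c + k + 1)))"
    by simp
  also have "(real k + 1) * fps_nth (hyp_fps a b c) (Suc k) = hyp_deriv_coeff a b c k"
    by (simp add: hyp_deriv_coeff_def)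
  finally show ?thesis .
qed

lemma hyp_deriv_coeff_pos:
  assumes "a > 0" "b > 0" "c > 0"
  shows "hyp_deriv_coeff a b c k > 0"
  using hyp_fps_pos[OF assms, of "Suc k"] by (simp add: hyp_deriv_coeff_def)

definition G_log_deriv :: "real \<Rightarrow> real \<Rightarrow> real \<Rightarrow> real \<Rightarrow> real fps" where
  "G_log_deriv a b c p = fps_deriv (hyp_fps a b c) - fps_const p * geometric_fps"

text \<open>
  The formal solution of \<open>G' = G L\<close> with the right initial value: the exponential of \<open>F + p ln(1 - x)\<close>,
  with the constant term \<open>F(0) = 1\<close> split off because only series without constant term can be
  composed.
\<close>

definition G_fps :: "real \<Rightarrow> real \<Rightarrow> real \<Rightarrow> real \<Rightarrow> real fps" where
  "G_fps a b c p = fps_const (exp 1) * (fps_exp 1 oo fps_integral0 (G_log_deriv a b c p))"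

lemma G_log_deriv_nth: "fps_nth (G_log_deriv a b c p) k = hyp_deriv_coeff a b c k - p"
  by (simp add: G_log_deriv_def hyp_deriv_coeff_def)

lemma G_fps_ode: "fps_deriv (G_fps a b c p) = G_fps a b c p * G_log_deriv a b c p"
  by (simp add: G_fps_def fps_compose_deriv fps_deriv_fps_integral mult_ac)

lemma G_fps_0: "fps_nth (G_fps a b c p) 0 = exp 1"
  by (simp add: G_fps_def)

lemma fps_conv_radius_G_log_deriv:
  assumes "a > 0" "b > 0" "c > 0"
  shows "1 \<le> fps_conv_radius (G_log_deriv a b c p)"
proof -
  have "1 \<le> fps_conv_radius (fps_deriv (hyp_fps a b c))"
    using fps_conv_radius_deriv[of "hyp_fps a b c"] fps_conv_radius_hyp[OF assms] by simp
  moreover have "1 \<le> fps_conv_radius (fps_const p * geometric_fps)"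
    using fps_conv_radius_mult[of "fps_const p" geometric_fps]
    by (simp add: fps_conv_radius_geometric)
  ultimately have "1 \<le> min (fps_conv_radius (fps_deriv (hyp_fps a b c)))
      (fps_conv_radius (fps_const p * geometric_fps))" by simp
  also have "\<dots> \<le> fps_conv_radius (G_log_deriv a b c p)"
    unfolding G_log_deriv_def by (rule fps_conv_radius_diff)
  finally show ?thesis .
qed

lemma fps_conv_radius_G:
  assumes "a > 0" "b > 0" "c > 0"
  shows "1 \<le> fps_conv_radius (G_fps a b c p)"
  using fps_conv_radius_G_log_deriv[OF assms] fps_conv_radius_log_deriv[OF G_fps_ode]
  by (rule order.trans)

lemma eval_G_log_deriv:
  assumes "a > 0" "b > 0" "c > 0" "\<bar>x\<bar> < 1"
  shows "eval_fps (G_log_deriv a b c p) x = eval_fps (fps_deriv (hyp_fps a b c)) x - p / (1 - x)"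
proof -
  have x: "ereal \<bar>x\<bar> < 1" using assms by (simp add: one_ereal_def)
  have "1 \<le> fps_conv_radius (fps_deriv (hyp_fps a b c))"
    using fps_conv_radius_deriv[of "hyp_fps a b c"] fps_conv_radius_hyp[OF assms(1-3)] by simp
  with x have 1: "ereal \<bar>x\<bar> < fps_conv_radius (fps_deriv (hyp_fps a b c))"
    by (rule less_le_trans)
  have "1 \<le> fps_conv_radius (fps_const p * geometric_fps)"
    using fps_conv_radius_mult[of "fps_const p" geometric_fps]
    by (simp add: fps_conv_radius_geometric)
  with x have 2: "ereal \<bar>x\<bar> < fps_conv_radius (fps_const p * geometric_fps)"
    by (rule less_le_trans)
  show ?thesis
    unfolding G_log_deriv_def using 1 2 x assms(4)
    by (simp add: eval_fps_diff eval_fps_mult fps_conv_radius_geometric eval_fps_geometric)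
qed

text \<open>
  On \<open>(-1, 1)\<close> both sides solve the same first-order linear differential equation and take
  the value \<open>e\<close> at 0, so their quotient \<open>h\<close> is constant.
\<close>

lemma eval_G_fps:
  assumes abc: "a > 0" "b > 0" "c > 0" and x: "\<bar>x\<bar> < 1"
  shows "eval_fps (G_fps a b c p) x = G_fun a b c p x"
proof -
  define h where
    "h y = eval_fps (G_fps a b c p) y * exp (- eval_fps (hyp_fps a b c) y - p * ln (1 - y))" for y
  have "\<exists>k. \<forall>y\<in>{-1<..<1}. h y = k"
  proof (rule has_field_derivative_zero_constant)
    fix y :: real assume "y \<in> {-1<..<1}"
    then have y: "\<bar>y\<bar> < 1" "ereal \<bar>y\<bar> < 1" by (auto simp: one_ereal_def)
    have r: "ereal \<bar>y\<bar> < fps_conv_radius (G_fps a b c p)"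
       "ereal \<bar>y\<bar> < fps_conv_radius (G_log_deriv a b c p)"
       "ereal \<bar>y\<bar> < fps_conv_radius (hyp_fps a b c)"
      using less_le_trans[OF y(2) fps_conv_radius_G[OF abc]]
        less_le_trans[OF y(2) fps_conv_radius_G_log_deriv[OF abc]] y(2)
      by (simp_all only: fps_conv_radius_hyp[OF abc])
    have dG: "(eval_fps (G_fps a b c p) has_field_derivative
        eval_fps (G_fps a b c p) y * (eval_fps (fps_deriv (hyp_fps a b c)) y - p / (1 - y))) (at y within {-1<..<1})"
      using has_field_derivative_eval_fps[of y "G_fps a b c p"] r y
      by (simp add: G_fps_ode eval_fps_mult eval_G_log_deriv[OF abc])
    have dF: "(eval_fps (hyp_fps a b c) has_field_derivative eval_fps (fps_deriv (hyp_fps a b c)) y) (at y within {-1<..<1})"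
      using has_field_derivative_eval_fps[of y "hyp_fps a b c"] r by simp
    show "(h has_field_derivative 0) (at y within {-1<..<1})"
      unfolding h_def using y
      by (auto intro!: derivative_eq_intros dG dF simp: field_simps)
  qed auto
  then obtain k where k: "\<And>y. \<bar>y\<bar> < 1 \<Longrightarrow> h y = k" by (auto simp: abs_less_iff)
  have "h x = h 0" using k[of x] k[of 0] x by simp
  also have "h 0 = 1"
    by (simp add: h_def eval_fps_at_0 G_fps_0 hyp_fps_def flip: exp_add)
  finally have "eval_fps (G_fps a b c p) x
      = exp (eval_fps (hyp_fps a b c) x + p * ln (1 - x))"
    by (simp add: h_def exp_diff exp_minus exp_add field_simps)
  then show ?thesis
    using x by (simp add: G_fun_def eval_hyp_fps powr_def exp_add mult.commute)
qed

lemma maclaurin_coeff_eq_fps_nth: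
  assumes "f has_fps_expansion F"
  shows "maclaurin_coeff f n = fps_nth F n"
proof -
  have "(deriv ^^ n) f has_fps_expansion (fps_deriv ^^ n) F"
  proof (induction n)
    case (Suc n)
    then show ?case by (simp add: has_fps_expansion_deriv)
  qed (simp add: assms)
  then have "eval_fps ((fps_deriv ^^ n) F) 0 = (deriv ^^ n) f 0"
    unfolding has_fps_expansion_def by (blast dest: eventually_nhds_x_imp_x)
  then have "(deriv ^^ n) f 0 = eval_fps ((fps_deriv ^^ n) F) 0" ..
  also have "\<dots> = fact n * fps_nth F n"
    by (simp add: eval_fps_at_0 fps_0th_higher_deriv)
  finally show ?thesis by (simp add: maclaurin_coeff_def)
qed

lemma v_coeff_eq_G_fps_nth:
  assumes "a > 0" "b > 0" "c > 0"
  shows "v_coeff a b c p n = fps_nth (G_fps a b c p) n"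
proof -
  have "eventually (\<lambda>x::real. x \<in> {-1<..<1}) (nhds 0)"
    by (intro eventually_nhds_in_open) auto
  then have "eventually (\<lambda>x. eval_fps (G_fps a b c p) x = G_fun a b c p x) (nhds 0)"
    by eventually_elim (auto intro!: eval_G_fps assms)
  moreover have "0 < fps_conv_radius (G_fps a b c p)"
    by (rule less_le_trans[OF _ fps_conv_radius_G[OF assms]]) simp
  ultimately have "G_fun a b c p has_fps_expansion G_fps a b c p"
    by (simp add: has_fps_expansion_def)
  then show ?thesis
    by (simp add: v_coeff_def maclaurin_coeff_eq_fps_nth)
qed

text \<open>
  The partial sums are the coefficients of \<open>G/(1 - x) = (1 - x)\<^sup>p\<^sup>-\<^sup>1 exp F(x)\<close>, a function of the same
  kind whose logarithmic derivative has only positive coefficients when \<open>p \<le> 1\<close>.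
\<close>

lemma G_fps_partial_sum_pos:
  assumes "a > 0" "b > 0" "c > 0" "p \<le> 1"
  shows "(\<Sum>j\<le>n. fps_nth (G_fps a b c p) j) > 0"
proof -
  let ?S = "G_fps a b c p * geometric_fps"
  have "fps_deriv ?S = ?S * (G_log_deriv a b c p + geometric_fps)"
    by (simp add: G_fps_ode fps_deriv_geometric algebra_simps)
  moreover have "fps_nth (G_log_deriv a b c p + geometric_fps) k > 0" for k
    using hyp_deriv_coeff_pos[OF assms(1-3), of k] assms(4) by (simp add: G_log_deriv_nth)
  moreover have "fps_nth ?S 0 > 0" by (simp add: G_fps_0)
  ultimately have "fps_nth ?S n > 0"
    using log_deriv_coeffs_pos[of ?S "G_log_deriv a b c p + geometric_fps" 0 n]
    by (cases n) (auto intro: less_imp_le)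
  then show ?thesis by (simp add: fps_nth_mult_geometric)
qed

lemma eval_G_fps_pos:
  assumes "a > 0" "b > 0" "c > 0" "\<bar>x\<bar> < 1"
  shows "eval_fps (G_fps a b c p) x > 0"
  using assms by (simp add: eval_G_fps G_fun_def)

section \<open>Growth of the coefficients of F'\<close>

lemma hyp_deriv_coeff_increasing:
  assumes "a > 0" "b > 0" "c > 0" "c \<le> a + b"
  shows "hyp_deriv_coeff a b c k < hyp_deriv_coeff a b c (Suc k)"
proof -
  have denom: "0 < (real k + 1) * (c + k + 1)" using assms(3) by simp
  have "c * (real k + 1) < a * b + (a + b) * (real k + 1)"
    using mult_right_mono[OF assms(4), of "real k + 1"] mult_pos_pos[OF assms(1,2)] by linarith
  then have "1 < (a + k + 1) * (b + k + 1) / ((real k + 1) * (c + k + 1))"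
    unfolding less_divide_eq_1_pos[OF denom] by (simp add: algebra_simps)
  from mult_strict_left_mono[OF this, of "hyp_deriv_coeff a b c k"] show ?thesis
    using hyp_deriv_coeff_Suc[of a b c k] hyp_deriv_coeff_pos[OF assms(1-3), of k]
    by simp
qed

lemma hyp_deriv_coeff_decreasing:
  assumes "a > 0" "b > 0" "c > 0" "c \<ge> a + b + a * b"
  shows "hyp_deriv_coeff a b c (Suc k) \<le> hyp_deriv_coeff a b c k"
    and "k > 0 \<Longrightarrow> hyp_deriv_coeff a b c (Suc k) < hyp_deriv_coeff a b c k"
proof -
  have ab: "a * b > 0" using assms by simp
  have denom: "0 < (real k + 1) * (c + k + 1)" using assms(3) by simp
  have *: "a * b * (real k + 1) + (a + b) * (real k + 1) \<le> c * (real k + 1)"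
    using mult_right_mono[OF assms(4), of "real k + 1"] by (simp add: algebra_simps)
  then have "a * b + (a + b) * (real k + 1) \<le> c * (real k + 1)"
    using mult_nonneg_nonneg[of "a * b" "real k"] ab by (simp add: algebra_simps)
  then have "(a + k + 1) * (b + k + 1) / ((real k + 1) * (c + k + 1)) \<le> 1"
    unfolding divide_le_eq_1_pos[OF denom] by (simp add: algebra_simps)
  from mult_left_mono[OF this, of "hyp_deriv_coeff a b c k"]
  show "hyp_deriv_coeff a b c (Suc k) \<le> hyp_deriv_coeff a b c k"
    using hyp_deriv_coeff_Suc[of a b c k] hyp_deriv_coeff_pos[OF assms(1-3), of k]
    by simp
  assume "k > 0"
  then have "a * b + (a + b) * (real k + 1) < c * (real k + 1)"
    using * mult_pos_pos[of "a * b" "real k"] ab by (simp add: algebra_simps)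
  then have "(a + k + 1) * (b + k + 1) / ((real k + 1) * (c + k + 1)) < 1"
    unfolding divide_less_eq_1_pos[OF denom] by (simp add: algebra_simps)
  from mult_strict_left_mono[OF this, of "hyp_deriv_coeff a b c k"]
  show "hyp_deriv_coeff a b c (Suc k) < hyp_deriv_coeff a b c k"
    using hyp_deriv_coeff_Suc[of a b c k] hyp_deriv_coeff_pos[OF assms(1-3), of k]
    by simp
qed

text \<open>
  For \<open>c = a + b\<close> the numerator \<open>(a + k + 1) (b + k + 1)\<close> differs from the denominator
  \<open>(k + 1) (c + k + 1)\<close> by the constant \<open>ab\<close>.
\<close>

lemma hyp_deriv_coeff_balanced_Suc:
  assumes "a > 0" "b > 0" "c = a + b"
  shows "hyp_deriv_coeff a b c (Suc k)
           = hyp_deriv_coeff a b c k * (1 + a * b / ((real k + 1) * (c + k + 1)))"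
proof -
  have "(a + k + 1) * (b + k + 1) / ((real k + 1) * (c + k + 1)) = 1 + a * b / ((real k + 1) * (c + k + 1))"
    using assms by (simp add: divide_simps) (simp add: algebra_simps)
  then show ?thesis
    using hyp_deriv_coeff_Suc[of a b c k] by simp
qed

text \<open>
  The factors are \<open>1 + \<tau>\<close> with \<open>\<tau> \<le> 2ab/((k + 1) (k + 2))\<close>, which telescopes. Since
  \<open>(1 + \<tau>) (1 - s - \<tau>) \<le> 1 - s\<close>, the product up to \<open>k\<close> is at most the reciprocal of
  \<open>1 - s\<^sub>k\<close>, where \<open>s\<^sub>k = 2ab k/(k + 1)\<close>. The smallness condition is precisely
  \<open>1 - 2ab \<ge> 1/(c + 1)\<close>.
\<close>

lemma hyp_deriv_coeff_balanced_bound: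
  assumes "a > 0" "b > 0" "c = a + b" and small: "2 * (a * b) * (c + 1) \<le> c"
  shows "hyp_deriv_coeff a b c k \<le> a * b / c * (c + 1)"
proof -
  let ?e = "hyp_deriv_coeff a b c"
  define s where "s k = 2 * (a * b) * (real k / (k + 1))" for k
  have c: "c > 0" and ab: "a * b > 0" using assms by auto
  have e: "?e k > 0" for k using hyp_deriv_coeff_pos c assms by simp
  have "?e k * (1 - s k) \<le> a * b / c"
  proof (induction k)
    case 0
    show ?case by (simp add: s_def hyp_deriv_coeff_0)
  next
    case (Suc k)
    define \<tau> where "\<tau> = a * b / ((real k + 1) * (c + k + 1))"
    have "\<tau> \<le> 2 * (a * b) / ((real k + 1) * (real k + 2))"
    proof -
      have "(real k + 1) * (real k + 2) \<le> (real k + 1) * (2 * (c + k + 1))"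
        using c by (intro mult_left_mono) auto
      then have "(real k + 1) * (real k + 2) \<le> 2 * ((real k + 1) * (c + k + 1))"
        by (simp only: mult.left_commute)
      then have "2 * (a * b) / (2 * ((real k + 1) * (c + k + 1))) \<le> 2 * (a * b) / ((real k + 1) * (real k + 2))"
        using ab c by (intro divide_left_mono) auto
      also have "2 * (a * b) / (2 * ((real k + 1) * (c + k + 1))) = \<tau>"
        unfolding \<tau>_def by (rule mult_divide_mult_cancel_left) simp
      finally show ?thesis .
    qed
    also have "\<dots> = s (Suc k) - s k"
      by (simp add: s_def divide_simps) (simp add: algebra_simps)
    finally have "\<tau> \<le> s (Suc k) - s k" .
    moreover have "\<tau> \<ge> 0" "s k \<ge> 0" using c ab by (simp_all add: \<tau>_def s_def)
    ultimately have "(1 + \<tau>) * (1 - s (Suc k)) \<le> (1 + \<tau>) * (1 - s k - \<tau>)"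
      by (intro mult_left_mono) auto
    also have "\<dots> = 1 - s k - (\<tau> * s k + \<tau> * \<tau>)" by (simp add: algebra_simps)
    also have "\<dots> \<le> 1 - s k"
      using mult_nonneg_nonneg[OF \<open>\<tau> \<ge> 0\<close> \<open>s k \<ge> 0\<close>] zero_le_square[of \<tau>] by linarith
    finally have "?e k * ((1 + \<tau>) * (1 - s (Suc k))) \<le> ?e k * (1 - s k)"
      using e[of k] by (intro mult_left_mono) auto
    with Suc.IH show ?case
      unfolding hyp_deriv_coeff_balanced_Suc[OF assms(1-3)] \<tau>_def[symmetric]
      by (simp only: mult.assoc)
  qed
  moreover have "1 / (c + 1) \<le> 1 - s k"
  proof -
    have "s k \<le> 2 * (a * b) * 1"
      unfolding s_def using ab by (intro mult_left_mono) auto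
    also have "\<dots> \<le> c / (c + 1)" using small c by (simp add: field_simps)
    also have "\<dots> = 1 - 1 / (c + 1)" using c by (simp add: field_simps)
    finally show ?thesis by simp
  qed
  then have "?e k * (1 / (c + 1)) \<le> ?e k * (1 - s k)"
    using e[of k] by (intro mult_left_mono) auto
  ultimately have "?e k * (1 / (c + 1)) \<le> a * b / c" by linarith
  then show ?thesis using c by (simp add: pos_divide_le_eq)
qed

text \<open>
  Write \<open>\<epsilon> = ab\<close>, \<open>E = e\<^sub>k\<^sub>+\<^sub>1\<close>, \<open>T = p - E\<close>, and \<open>D\<^sub>1\<close>, \<open>D\<^sub>2\<close> for the denominators of two consecutive
  ratios. The neighbours of \<open>T\<close> are \<open>T + E \<epsilon>/(D\<^sub>1 + \<epsilon>)\<close> and \<open>T - E \<epsilon>/D\<^sub>2\<close>, so log-convexity amounts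
  to \<open>E \<epsilon> \<le> T (D\<^sub>2 - D\<^sub>1 - \<epsilon>)\<close>. As \<open>D\<^sub>2 - D\<^sub>1 = 2k + 3 + c\<close> is large, \<open>E \<epsilon> \<le> T\<close> suffices; it follows
  from \<open>E \<le> (ab/c) (c + 1)\<close>, from the resulting \<open>T \<ge> (ab/c) c\<close>, and from \<open>2 \<epsilon> (c + 1) \<le> c\<close>.
\<close>

lemma balanced_log_convex:
  assumes "a > 0" "b > 0" "c = a + b" and small: "2 * (a * b) * (c + 1) \<le> c"
    and p: "a * b / c * (2 * c + 1) \<le> p"
  defines "t \<equiv> \<lambda>k. p - hyp_deriv_coeff a b c k"
  shows "t k > 0" and "t (Suc k) ^ 2 \<le> t k * t (Suc (Suc k))"
proof -
  let ?e = "hyp_deriv_coeff a b c"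
  define \<epsilon> where "\<epsilon> = a * b"
  define w where "w = \<epsilon> / c"
  have c: "c > 0" and \<epsilon>: "\<epsilon> > 0" and w: "w > 0" using assms by (auto simp: \<epsilon>_def w_def)
  have e: "0 < ?e k" "?e k \<le> w * (c + 1)" for k
    using hyp_deriv_coeff_balanced_bound[OF assms(1-4)] hyp_deriv_coeff_pos c assms
    by (auto simp: w_def \<epsilon>_def)
  have t: "t k \<ge> w * c" for k
  proof -
    have "w * (2 * c + 1) \<le> p" using p by (simp add: w_def \<epsilon>_def)
    with e(2)[of k] show ?thesis by (simp add: t_def algebra_simps)
  qed
  show "t k > 0" using t[of k] mult_pos_pos[OF w c] by linarith
  define D\<^sub>1 where "D\<^sub>1 = (real k + 1) * (c + k + 1)"
  define D\<^sub>2 where "D\<^sub>2 = (real k + 2) * (c + k + 2)"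
  have D: "D\<^sub>1 > 0" "D\<^sub>2 > 0" using c by (auto simp: D\<^sub>1_def D\<^sub>2_def)
  define E where "E = ?e (Suc k)"
  define T where "T = t (Suc k)"
  have "E = ?e k * (1 + \<epsilon> / D\<^sub>1)"
    using hyp_deriv_coeff_balanced_Suc[OF assms(1-3), of k] by (simp add: E_def \<epsilon>_def D\<^sub>1_def)
  then have "?e k = E - E * \<epsilon> / (D\<^sub>1 + \<epsilon>)"
    using D \<epsilon> by (simp add: field_simps)
  then have t0: "t k = T + E * \<epsilon> / (D\<^sub>1 + \<epsilon>)" by (simp add: t_def T_def E_def)
  have "?e (Suc (Suc k)) = E * (1 + \<epsilon> / D\<^sub>2)"
    using hyp_deriv_coeff_balanced_Suc[OF assms(1-3), of "Suc k"]
    by (simp add: E_def \<epsilon>_def D\<^sub>2_def add_ac)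
  then have t2: "t (Suc (Suc k)) = T - E * \<epsilon> / D\<^sub>2"
    by (simp add: t_def T_def E_def algebra_simps)
  have "t k * t (Suc (Suc k)) - T ^ 2 = E * \<epsilon> * (T * (D\<^sub>2 - D\<^sub>1 - \<epsilon>) - E * \<epsilon>) / ((D\<^sub>1 + \<epsilon>) * D\<^sub>2)"
    unfolding t0 t2 using D \<epsilon>
    by (simp add: divide_simps) (simp add: algebra_simps power2_eq_square)
  also have "\<dots> \<ge> 0"
  proof -
    have "2 * \<epsilon> * (c + 1) \<le> c" using small by (simp add: \<epsilon>_def)
    have \<epsilon>1: "\<epsilon> \<le> 1"
    proof -
      have "0 < \<epsilon> * (c + 1)" using c \<epsilon> by simp
      then have "\<epsilon> * (c + 1) \<le> 1 * (c + 1)" using \<open>2 * \<epsilon> * (c + 1) \<le> c\<close> c by (simp add: algebra_simps)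
      then show ?thesis using c by (simp add: mult_le_cancel_right)
    qed
    have "E * \<epsilon> \<le> w * (c + 1) * \<epsilon>"
      unfolding E_def using e(2) \<epsilon> by (intro mult_right_mono) auto
    also have "\<dots> = w * ((c + 1) * \<epsilon>)" by simp
    also have "\<dots> \<le> w * c"
      using w \<open>2 * \<epsilon> * (c + 1) \<le> c\<close> \<epsilon> c by (intro mult_left_mono) (auto simp: algebra_simps)
    also have "\<dots> \<le> T" unfolding T_def by (rule t)
    also have "\<dots> = T * 1" by simp
    also have "\<dots> \<le> T * (D\<^sub>2 - D\<^sub>1 - \<epsilon>)"
    proof (rule mult_left_mono)
      have "D\<^sub>2 - D\<^sub>1 = 2 * k + 3 + c" by (simp add: D\<^sub>1_def D\<^sub>2_def algebra_simps)
      then show "1 \<le> D\<^sub>2 - D\<^sub>1 - \<epsilon>" using \<epsilon>1 c by simp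
      show "0 \<le> T" using t[of "Suc k"] mult_pos_pos[OF w c] by (simp add: T_def)
    qed
    finally show ?thesis using D \<epsilon> e(1)[of "Suc k"] by (simp add: E_def)
  qed
  finally show "t (Suc k) ^ 2 \<le> t k * t (Suc (Suc k))" by (simp add: T_def)
qed

text \<open>
  With \<open>w = ab/c\<close> and \<open>q = p - w\<close> the claim is \<open>w \<cdot> wc/(c + 1) < q (1 - q)\<close>. The hypotheses keep
  \<open>q\<close> away from 0 and 1, namely \<open>2wc \<le> q\<close> and \<open>w \<le> 1 - q\<close>. Whichever of \<open>q\<close> and \<open>1 - q\<close> is the
  larger one is at least \<open>1/2\<close>, and the lower bound for the other one is enough.
\<close>

lemma balanced_log_convex_start:
  assumes "a > 0" "b > 0" "c = a + b" and small: "2 * (a * b) * (c + 1) \<le> c"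
    and p: "a * b / c * (2 * c + 1) \<le> p" "p \<le> 1"
  shows "(p - hyp_deriv_coeff a b c 0) ^ 2 < p - hyp_deriv_coeff a b c 1"
proof -
  define w where "w = a * b / c"
  define q where "q = p - w"
  have c: "c > 0" and w: "w > 0" using assms by (auto simp: w_def)
  have ab: "a * b = w * c" using c by (simp add: w_def)
  have "2 * w * (c + 1) * c \<le> 1 * c" using small by (simp add: ab mult_ac)
  then have wc: "2 * w * (c + 1) \<le> 1" using c by (simp only: mult_le_cancel_right_pos)
  have q: "2 * (w * c) \<le> q" "w \<le> 1 - q" 
    using p by (simp_all add: q_def w_def[symmetric] algebra_simps)
  have wc0: "w * c > 0" using w c by simp
  have w1: "w < 1 / 2" using wc wc0 by (simp add: algebra_simps)
  have "w * (w * c) / (c + 1) < q * (1 - q)"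
  proof (cases "q \<le> 1 / 2")
    case True
    have "w * (w * c) / (c + 1) = (w * c) * (w / (c + 1))" by simp
    also have "\<dots> < w * c * 1"
      using wc wc0 w w1 c by (intro mult_strict_left_mono) (auto simp: field_simps)
    also have "\<dots> \<le> q / 2" using q by simp
    also have "\<dots> \<le> q * (1 - q)" using True q wc0 mult_left_mono[of "1/2" "1 - q" q] by simp
    finally show ?thesis .
  next
    case False
    have "w * (w * c) / (c + 1) = w * (w * c / (c + 1))" by simp
    also have "\<dots> < w * (1 / 2)"
      using wc wc0 w w1 c by (intro mult_strict_left_mono) (auto simp: field_simps)
    also have "\<dots> \<le> (1 - q) * q" using False q w by (intro mult_mono) auto
    finally show ?thesis by (simp add: mult.commute)
  qed
  moreover have "hyp_deriv_coeff a b c 0 = w"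
    by (simp add: hyp_deriv_coeff_0 w_def)
  moreover have "hyp_deriv_coeff a b c 1 = w + w * (w * c) / (c + 1)"
    using hyp_deriv_coeff_balanced_Suc[OF assms(1-3), of 0] 
    by (simp add: hyp_deriv_coeff_0 w_def[symmetric] ab[symmetric]) (simp add: algebra_simps)
  ultimately show ?thesis by (simp add: q_def algebra_simps power2_eq_square)
qed

section \<open>The inequalities\<close>

lemma less_hyp2F1_ln_iff:
  fixes y :: real
  assumes "a > 0" "b > 0" "c > 0" "0 < x" "x < 1" "0 < y"
  shows "ln (y / (1 - x) powr p) < hyp2F1 a b c x \<longleftrightarrow> y < eval_fps (G_fps a b c p) x"
    and "hyp2F1 a b c x < ln (y / (1 - x) powr p) \<longleftrightarrow> eval_fps (G_fps a b c p) x < y"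
proof -
  have G: "eval_fps (G_fps a b c p) x = (1 - x) powr p * exp (hyp2F1 a b c x)"
    using assms by (simp add: eval_G_fps G_fun_def)
  have y: "0 < y / (1 - x) powr p" using assms by simp
  show "ln (y / (1 - x) powr p) < hyp2F1 a b c x \<longleftrightarrow> y < eval_fps (G_fps a b c p) x"
    unfolding G using y assms
    by (subst exp_less_cancel_iff[symmetric]) (simp add: pos_divide_less_eq mult.commute)
  show "hyp2F1 a b c x < ln (y / (1 - x) powr p) \<longleftrightarrow> eval_fps (G_fps a b c p) x < y"
    unfolding G using y assms
    by (subst exp_less_cancel_iff[symmetric]) (simp add: pos_less_divide_eq mult.commute)
qed

theorem proposition4:
  fixes a b c p :: real and v :: "nat \<Rightarrow> real"
  assumes "a > 0" and "b > 0" and "c > 0"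
  defines "v \<equiv> v_coeff a b c p"
  shows
    "(c \<le> a + b \<longrightarrow>
        (p \<le> a * b / c \<longrightarrow>
          (\<forall>x\<in>{0<..<1}. \<forall>n\<ge>0.
             0 < (\<Sum>j=0..n. v j * x ^ j) / (1 - x) powr p \<and>
             hyp2F1 a b c x > ln ((\<Sum>j=0..n. v j * x ^ j) / (1 - x) powr p))) \<and>
        (c = a + b \<and> a + b \<ge> 2 * a * b * (a + b + 1) \<and>
         a * b * (2 * a + 2 * b + 1) / (a + b) \<le> p \<and> p \<le> 1 \<longrightarrow>
          (\<forall>x\<in>{0<..<1}. \<forall>n\<ge>1.
             0 < (\<Sum>j=0..n. v j * x ^ j) / (1 - x) powr p \<and>
             hyp2F1 a b c x < ln ((\<Sum>j=0..n. v j * x ^ j) / (1 - x) powr p)))) \<and>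
     (c \<ge> a + b + a * b \<longrightarrow>
        (a * b / c \<le> p \<and> p \<le> 1 \<longrightarrow>
          (\<forall>x\<in>{0<..<1}. \<forall>n\<ge>1.
             0 < ((\<Sum>j=0..n. v j * x ^ j) - (\<Sum>j=0..n. v j) * x ^ (n + 1)) / (1 - x) powr p \<and>
             ln (((\<Sum>j=0..n. v j * x ^ j) - (\<Sum>j=0..n. v j) * x ^ (n + 1)) / (1 - x) powr p)
               < hyp2F1 a b c x \<and>
             0 < (\<Sum>j=0..n+1. v j * x ^ j) / (1 - x) powr p \<and>
             hyp2F1 a b c x < ln ((\<Sum>j=0..n+1. v j * x ^ j) / (1 - x) powr p))))"
proof -
  note abc = assms(1-3)
  let ?G = "G_fps a b c p" and ?e = "hyp_deriv_coeff a b c"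
  have v: "v j = fps_nth ?G j" for j
    unfolding v_def by (rule v_coeff_eq_G_fps_nth[OF abc])
  have radius: "ereal x < fps_conv_radius ?G" if "x < 1" for x
    by (rule less_le_trans[OF _ fps_conv_radius_G[OF abc]]) (use that in \<open>simp add: one_ereal_def\<close>)
  have L: "fps_nth (G_log_deriv a b c p) k = - (p - ?e k)" for k
    by (simp add: G_log_deriv_nth)
  have G_pos: "eval_fps ?G x > 0" if "0 < x" "x < 1" for x
    using eval_G_fps_pos[OF abc] that by simp
  have lower: "0 < y / (1 - x) powr p \<and> ln (y / (1 - x) powr p) < hyp2F1 a b c x"
    if "0 < x" "x < 1" "0 < y" "y < eval_fps ?G x" for x y
    using that less_hyp2F1_ln_iff(1)[OF abc] by simp
  have upper: "0 < y / (1 - x) powr p \<and> hyp2F1 a b c x < ln (y / (1 - x) powr p)"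
    if "0 < x" "x < 1" "eval_fps ?G x < y" for x y
    using that less_hyp2F1_ln_iff(2)[OF abc that(1,2), of y p] G_pos[OF that(1,2)] by simp

  have part1a: "0 < (\<Sum>j=0..n. v j * x ^ j) / (1 - x) powr p \<and>
      hyp2F1 a b c x > ln ((\<Sum>j=0..n. v j * x ^ j) / (1 - x) powr p)"
    if c: "c \<le> a + b" and p: "p \<le> a * b / c" and x: "0 < x" "x < 1" for x n
  proof (rule lower[OF x])
    have "incseq ?e"
      using hyp_deriv_coeff_increasing[OF abc c] by (intro incseq_SucI less_imp_le)
    then have e: "?e 0 \<le> ?e k" "1 \<le> k \<Longrightarrow> ?e 1 \<le> ?e k" for k by (auto dest: incseqD)
    have "p \<le> ?e 0" "?e 0 < ?e 1"
      using p hyp_deriv_coeff_increasing[OF abc c, of 0] by (simp_all add: hyp_deriv_coeff_0)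
    then have L0: "fps_nth (G_log_deriv a b c p) k \<ge> 0" "1 \<le> k \<Longrightarrow> fps_nth (G_log_deriv a b c p) k > 0" for k
      using e(1)[of k] e(2)[of k] by (auto simp: L)
    have g0: "fps_nth ?G 0 > 0" by (simp add: G_fps_0)
    have nonneg: "fps_nth ?G j \<ge> 0" for j
      using G_fps_ode g0 L0 by (rule log_deriv_coeffs_nonneg)
    have pos: "1 < j \<Longrightarrow> fps_nth ?G j > 0" for j
      using G_fps_ode g0 L0 by (rule log_deriv_coeffs_pos)
    show "0 < (\<Sum>j=0..n. v j * x ^ j)"
      using nonneg g0 x by (intro sum_pos2[where i = 0]) (auto simp: v)
    show "(\<Sum>j=0..n. v j * x ^ j) < eval_fps ?G x"
      unfolding v using nonneg pos[of "n + 2"] x radius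
      by (intro truncation_less_eval_fps[where m = "n + 2"]) auto
  qed

  have part1b: "0 < (\<Sum>j=0..n. v j * x ^ j) / (1 - x) powr p \<and>
      hyp2F1 a b c x < ln ((\<Sum>j=0..n. v j * x ^ j) / (1 - x) powr p)"
    if c: "c = a + b" and small: "a + b \<ge> 2 * a * b * (a + b + 1)"
      and p: "a * b * (2 * a + 2 * b + 1) / (a + b) \<le> p" "p \<le> 1" and x: "0 < x" "x < 1" for x n
  proof (rule upper[OF x])
    have small': "2 * (a * b) * (c + 1) \<le> c" using small c by (simp add: mult_ac)
    have p': "a * b / c * (2 * c + 1) \<le> p" using p c by simp
    note convex = balanced_log_convex[OF abc(1,2) c small' p']
    have "fps_nth ?G (Suc j) < 0" for j
      using G_fps_ode _ L convex balanced_log_convex_start[OF abc(1,2) c small' p' p(2)]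
      by (rule log_deriv_coeffs_neg_if_log_convex) (simp add: G_fps_0)
    then have neg: "fps_nth ?G j < 0" if "j > 0" for j
      using that by (cases j) auto
    show "eval_fps ?G x < (\<Sum>j=0..n. v j * x ^ j)"
      unfolding v using neg x radius
      by (intro eval_fps_less_truncation[where m = "Suc n"]) (auto intro: less_imp_le)
  qed

  have part2_lower: "0 < y / (1 - x) powr p \<and> ln (y / (1 - x) powr p) < hyp2F1 a b c x"
    if p: "p \<le> 1" and x: "0 < x" "x < 1"
      and y: "y = (\<Sum>j=0..n. v j * x ^ j) - (\<Sum>j=0..n. v j) * x ^ (n + 1)" for x n y
  proof (rule lower[OF x])
    let ?S = "?G * geometric_fps"
    have S: "fps_nth ?S m > 0" for m
      using G_fps_partial_sum_pos[OF abc p] by (simp add: fps_nth_mult_geometric)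
    have y': "y = (1 - x) * (\<Sum>m=0..n. fps_nth ?S m * x ^ m)"
      unfolding y geometric_truncation by (simp add: v fps_nth_mult_geometric)
    have "(\<Sum>m=0..n. fps_nth ?S m * x ^ m) > 0"
      using S x by (intro sum_pos) auto
    then show "0 < y" using x by (simp add: y')
    have r: "ereal x < fps_conv_radius geometric_fps"
      using x by (simp add: fps_conv_radius_geometric one_ereal_def)
    have "(\<Sum>m=0..n. fps_nth ?S m * x ^ m) < eval_fps ?S x"
    proof (rule truncation_less_eval_fps[where m = "Suc n"])
      show "ereal x < fps_conv_radius ?S"
        using fps_conv_radius_mult[of ?G geometric_fps] radius[OF x(2)] r
        by (metis less_le_trans min_less_iff_conj)
    qed (use S x in \<open>auto intro: less_imp_le\<close>)
    also have "eval_fps ?S x = eval_fps ?G x * (1 / (1 - x))"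
      using x r radius[OF x(2)] by (simp add: eval_fps_mult eval_fps_geometric)
    finally show "y < eval_fps ?G x"
      using x by (simp add: y' pos_less_divide_eq mult.commute)
  qed

  have part2_upper: "0 < (\<Sum>j=0..n+1. v j * x ^ j) / (1 - x) powr p \<and>
      hyp2F1 a b c x < ln ((\<Sum>j=0..n+1. v j * x ^ j) / (1 - x) powr p)"
    if c: "c \<ge> a + b + a * b" and p: "a * b / c \<le> p" "p \<le> 1" and x: "0 < x" "x < 1"
      and n: "n \<ge> 1" for x n
  proof (rule upper[OF x])
    have "decseq ?e" by (intro decseq_SucI hyp_deriv_coeff_decreasing[OF abc c])
    then have e: "?e k \<le> ?e 0" "1 \<le> k \<Longrightarrow> ?e k \<le> ?e 1" for k by (auto dest: decseqD)
    have mono: "mono (\<lambda>k. p - ?e k)"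
      using \<open>decseq ?e\<close> by (auto simp: monotone_def)
    have e0: "?e 0 \<le> p" using p by (simp add: hyp_deriv_coeff_0)
    then have nonneg: "0 \<le> p - ?e k" for k using e(1)[of k] by simp
    \<comment> \<open>Strictness cannot start earlier: if \<open>c = a + b + ab\<close> and \<open>p = ab/c\<close>, then \<open>e\<^sub>0 = e\<^sub>1 = p\<close>.\<close>
    have pos: "0 < p - ?e k" if k2: "k \<ge> 2" for k
    proof -
      obtain j where "k = Suc j" "j > 0" using k2 by (cases k) auto
      then show ?thesis
        using hyp_deriv_coeff_decreasing(2)[OF abc c, of j] e(1)[of j] e0 by simp
    qed
    have neg: "fps_nth ?G j < 0" if j3: "j \<ge> 3" for j
    proof -
      obtain k where k: "j = Suc k" "k \<ge> 2" using j3 by (cases j) auto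
      show ?thesis
        using log_deriv_coeffs_neg_if_partial_sums_pos[OF G_fps_ode L nonneg mono
            G_fps_partial_sum_pos[OF abc p(2)] pos[OF k(2)]] k(1) by simp
    qed
    show "eval_fps ?G x < (\<Sum>j=0..n+1. v j * x ^ j)"
      unfolding v using neg x radius n
      by (intro eval_fps_less_truncation[where m = "n + 2"]) (auto intro: less_imp_le)
  qed

  show ?thesis
    using part1a part1b part2_lower part2_upper by simp
qed

end
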